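(* Let $\alpha>1$, $\beta>0$, let $\pi$ be the Gamma probability measure on $(0,+\infty)$ given by $\pi(\mathrm{d}r)=\frac{1}{\Gamma(\alpha)\beta^\alpha}r^{\alpha-1}\exp(-r/\beta)\,\mathrm{d}r$, and let $q>0$. Then the condition $$\int_0^{+\infty}\exp_q\left(\frac{\lambda_0}{r}\right)\pi(\mathrm{d}r)<+\infty\quad\text{for some }\lambda_0>0$$ is satisfied if and only if $0<q<1-\alpha^{-1}$.
   Context: $\Gamma$ is the Gamma function. The $q$-exponential is defined, for real $x$ with $1+(1-q)x>0$, by $\exp_q(x)=(1+(1-q)x)^{\frac{1}{1-q}}$ if $q\neq1$, and $\exp_1(x)=\exp(x)$. The integrability condition is understood to include the requirement that the integrand is defined for all $r>0$, i.e. that $1+(1-q)\lambda_0/r>0$ for all $r>0$; the condition is regarded as not satisfied for a given $\lambda_0$ if this fails. *)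

theory Defs
  imports "HOL-Probability.Probability"
begin

definition gamma_density :: "real \<Rightarrow> real \<Rightarrow> real \<Rightarrow> real" where
  "gamma_density \<alpha> \<beta> r =
     (if r > 0 then 1 / (Gamma \<alpha> * \<beta> powr \<alpha>) * r powr (\<alpha> - 1) * exp (- r / \<beta>) else 0)"

(* The Gamma law with shape \<alpha> and scale \<beta>, as a measure on the real line carried by (0, +oo). *)
definition gamma_measure :: "real \<Rightarrow> real \<Rightarrow> real measure" where
  "gamma_measure \<alpha> \<beta> = density lborel (\<lambda>r. ennreal (gamma_density \<alpha> \<beta> r))"

definition exp_q_defined :: "real \<Rightarrow> real \<Rightarrow> bool" where
  "exp_q_defined q x \<longleftrightarrow> 1 + (1 - q) * x > 0"

(* Only meaningful where exp_q_defined q x holds. *)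
definition exp_q :: "real \<Rightarrow> real \<Rightarrow> real" where
  "exp_q q x = (if q = 1 then exp x else (1 + (1 - q) * x) powr (1 / (1 - q)))"

(* On the domain exp_q is positive, so applying ennreal does not change the integrand. *)
definition exp_q_integrable :: "real measure \<Rightarrow> real \<Rightarrow> real \<Rightarrow> bool" where
  "exp_q_integrable M q l \<longleftrightarrow>
     (\<forall>r>0. exp_q_defined q (l / r)) \<and>
     (\<integral>\<^sup>+ r\<in>{0<..}. ennreal (exp_q q (l / r)) \<partial>M) < \<infinity>"

end

theory Submission
  imports Defs
begin

text \<open>Near \<open>r = 0\<close> the \<open>q\<close>-exponential of \<open>\<lambda>\<^sub>0 / r\<close> behaves like \<open>r powr (- 1 / (1 - q))\<close> when
  \<open>q < 1\<close>, so the integral converges at \<open>0\<close> exactly when \<open>1 / (1 - q) < \<alpha>\<close>. For \<open>q = 1\<close> the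
  integrand dominates every negative power of \<open>r\<close>, and for \<open>q > 1\<close> it is undefined near \<open>0\<close>.\<close>

text \<open>The substitution \<open>t = r / \<beta>\<close> turns Euler's integral for
  \<open>Gamma s\<close> into a positive finite multiple of this one, so finiteness of
  \<open>Gamma s\<close> carries over.\<close>

lemma nn_integral_powr_exp_finite:
  fixes s \<beta> :: real
  assumes "s > 0" "\<beta> > 0"
  shows "(\<integral>\<^sup>+ r\<in>{0<..}. ennreal (r powr (s - 1) * exp (- r / \<beta>)) \<partial>lborel) < \<infinity>"
proof -
  have "ennreal (Gamma s) =
      (\<integral>\<^sup>+ t. ennreal (indicator {0..} t * t powr (s - 1) / exp t) \<partial>lborel)"
    using Gamma_conv_nn_integral_real[OF \<open>s > 0\<close>] by simp
  also have "\<dots> = ennreal \<bar>1 / \<beta>\<bar> * (\<integral>\<^sup>+ r. ennreal (indicator {0..} (0 + 1 / \<beta> * r) *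
      (0 + 1 / \<beta> * r) powr (s - 1) / exp (0 + 1 / \<beta> * r)) \<partial>lborel)"
    using \<open>\<beta> > 0\<close> by (intro nn_integral_real_affine) auto
  \<comment> \<open>The closed and the open half-line give the same integrand everywhere, because
    \<open>0 powr (s - 1) = 0\<close> by convention.\<close>
  also have "\<dots> = ennreal (1 / \<beta>) * (\<integral>\<^sup>+ r. ennreal ((1 / \<beta>) powr (s - 1)) *
      (ennreal (r powr (s - 1) * exp (- r / \<beta>)) * indicator {0<..} r) \<partial>lborel)"
    using \<open>\<beta> > 0\<close>
    by (intro arg_cong2[where f = "(*)"] nn_integral_cong)
      (auto simp: indicator_def powr_mult powr_divide exp_minus field_simps zero_le_divide_iff
        simp flip: ennreal_mult)
  also have "\<dots> = ennreal (1 / \<beta>) * (ennreal ((1 / \<beta>) powr (s - 1)) *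
      (\<integral>\<^sup>+ r\<in>{0<..}. ennreal (r powr (s - 1) * exp (- r / \<beta>)) \<partial>lborel))"
    by (subst nn_integral_cmult) auto
  finally have "ennreal (1 / \<beta>) * (ennreal ((1 / \<beta>) powr (s - 1)) *
      (\<integral>\<^sup>+ r\<in>{0<..}. ennreal (r powr (s - 1) * exp (- r / \<beta>)) \<partial>lborel)) < \<infinity>"
    by (metis ennreal_less_top infinity_ennreal_def)
  then show ?thesis
    using \<open>\<beta> > 0\<close> by (auto simp: ennreal_mult_less_top ennreal_zero_less_divide)
qed

lemma nn_integral_inverse_Ioc_01:
  "(\<integral>\<^sup>+ r\<in>{0<..1}. ennreal (1 / r) \<partial>lborel) = (\<infinity> :: ennreal)"
proof (rule ccontr)
  assume "\<not> ?thesis"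
  then obtain c where c: "c \<ge> 0" "(\<integral>\<^sup>+ r\<in>{0<..1}. ennreal (1 / r) \<partial>lborel) = ennreal c"
    by (metis ennreal_cases infinity_ennreal_def)
  \<comment> \<open>Chosen so that \<open>- ln a = c + 1\<close>: the part over
    \<open>{a..1}\<close> alone already exceeds the supposed total \<open>c\<close>.\<close>
  define a where "a = exp (- (c + 1))"
  have a: "0 < a" "a \<le> 1" using c by (auto simp: a_def)
  have "ennreal (c + 1) = ennreal (ln 1 - ln a)" by (simp add: a_def add.commute)
  also have "\<dots> = (\<integral>\<^sup>+ r. ennreal (1 / r) * indicator {a..1} r \<partial>lborel)"
    using a by (intro nn_integral_FTC_Icc[symmetric])
      (auto intro!: derivative_eq_intros simp flip: has_real_derivative_iff_has_vector_derivative)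
  also have "\<dots> \<le> (\<integral>\<^sup>+ r\<in>{0<..1}. ennreal (1 / r) \<partial>lborel)"
    using a by (intro nn_integral_mono) (auto simp: indicator_def)
  finally show False using c by (simp add: ennreal_le_iff)
qed

lemma nn_integral_gamma_measure:
  assumes [measurable]: "f \<in> borel_measurable borel"
  shows "(\<integral>\<^sup>+ r\<in>{0<..}. f r \<partial>gamma_measure \<alpha> \<beta>) =
    (\<integral>\<^sup>+ r\<in>{0<..}. ennreal (gamma_density \<alpha> \<beta> r) * f r \<partial>lborel)"
proof -
  have [measurable]: "gamma_density \<alpha> \<beta> \<in> borel_measurable borel"
    unfolding gamma_density_def by measurable
  show ?thesis
    unfolding gamma_measure_def by (subst nn_integral_density) (auto simp: mult.assoc)
qed

text \<open>Divergence criterion at 0: the factor \<open>r powr (\<alpha> - 1)\<close> of the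
  density times \<open>r powr (- \<alpha>)\<close> is \<open>1 / r\<close>, which is not integrable
  on \<open>{0<..1}\<close>.\<close>

lemma nn_integral_gamma_measure_eq_infinity:
  fixes f :: "real \<Rightarrow> real"
  assumes "\<alpha> > 0" "\<beta> > 0" "C > 0"
    and [measurable]: "f \<in> borel_measurable borel"
    and f: "\<And>r. 0 < r \<Longrightarrow> r \<le> 1 \<Longrightarrow> C * r powr (- \<alpha>) \<le> f r"
  shows "(\<integral>\<^sup>+ r\<in>{0<..}. ennreal (f r) \<partial>gamma_measure \<alpha> \<beta>) = \<infinity>"
proof -
  define K where "K = 1 / (Gamma \<alpha> * \<beta> powr \<alpha>)"
  \<comment> \<open>On \<open>{0<..1}\<close> the exponential factor of the density is smallest at
    \<open>r = 1\<close>, which gives the middle factor.\<close>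
  define D where "D = K * exp (- 1 / \<beta>) * C"
  have K: "K > 0" using assms by (simp add: K_def Gamma_real_pos)
  have D: "D > 0" using K assms by (simp add: D_def)
  have le: "D * (1 / r) \<le> gamma_density \<alpha> \<beta> r * f r" if r: "0 < r" "r \<le> 1" for r
  proof -
    have "D * (1 / r) = (K * r powr (\<alpha> - 1) * exp (- 1 / \<beta>)) * (C * r powr (- \<alpha>))"
      using r by (simp add: D_def powr_diff powr_minus field_simps)
    also have "\<dots> \<le> (K * r powr (\<alpha> - 1) * exp (- r / \<beta>)) * f r"
      using r K assms(2,3) f[OF r] by (intro mult_mono) (auto simp: divide_right_mono)
    finally show ?thesis using r by (simp add: gamma_density_def K_def)
  qed
  have "\<infinity> = ennreal D * (\<integral>\<^sup>+ r\<in>{0<..1}. ennreal (1 / r) \<partial>lborel)"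
    using D by (simp add: nn_integral_inverse_Ioc_01 ennreal_mult_top)
  also have "\<dots> = (\<integral>\<^sup>+ r\<in>{0<..1}. ennreal D * ennreal (1 / r) \<partial>lborel)"
    by (subst nn_integral_cmult[symmetric]) (auto simp: mult.assoc)
  also have "\<dots> \<le> (\<integral>\<^sup>+ r\<in>{0<..}. ennreal (gamma_density \<alpha> \<beta> r) * ennreal (f r) \<partial>lborel)"
  proof (intro nn_integral_mono)
    fix r :: real
    show "ennreal D * ennreal (1 / r) * indicator {0<..1} r \<le>
      ennreal (gamma_density \<alpha> \<beta> r) * ennreal (f r) * indicator {0<..} r"
    proof (cases "0 < r \<and> r \<le> 1")
      case True
      then have "0 \<le> gamma_density \<alpha> \<beta> r"
        using K by (simp add: gamma_density_def K_def)
      then show ?thesis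
        using True le[of r] D by (simp add: ennreal_leI flip: ennreal_mult' ennreal_mult'')
    qed (auto simp: indicator_def)
  qed
  also have "\<dots> = (\<integral>\<^sup>+ r\<in>{0<..}. ennreal (f r) \<partial>gamma_measure \<alpha> \<beta>)"
    by (subst nn_integral_gamma_measure) auto
  finally show ?thesis by (simp add: top_unique)
qed

lemma borel_measurable_exp_q [measurable]: "exp_q q \<in> borel_measurable borel"
  unfolding exp_q_def by (cases "q = 1") auto

text \<open>The value \<open>1 / (1 - q)\<close> for the parameter cancels the factor
  \<open>1 - q\<close>, so that the integrand is simply
  \<open>(1 + 1 / r) powr (1 / (1 - q))\<close>.\<close>

lemma exp_q_integrable_gamma_measure:
  assumes "\<alpha> > 1" "\<beta> > 0" "q < 1 - 1 / \<alpha>"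
  shows "exp_q_integrable (gamma_measure \<alpha> \<beta>) q (1 / (1 - q))"
proof -
  define p where "p = 1 / (1 - q)"
  have "0 < 1 / \<alpha>" using assms by simp
  then have q: "q < 1" using assms by linarith
  \<comment> \<open>Given \<open>q < 1\<close>, the bound \<open>p < \<alpha>\<close> is the
    hypothesis \<open>q < 1 - 1 / \<alpha>\<close> rearranged.\<close>
  have p: "p > 0" "p < \<alpha>" using assms q by (auto simp: p_def field_simps)
  define K where "K = 1 / (Gamma \<alpha> * \<beta> powr \<alpha>)"
  have K: "K > 0" using assms by (simp add: K_def Gamma_real_pos)
  have q1: "(1 - q) * (1 / (1 - q) / r) = 1 / r" for r using q by simp
  \<comment> \<open>The base is at most \<open>2 / r\<close> for \<open>r \<le> 1\<close> and at
    most \<open>2\<close> beyond; adding the two bounds covers both ranges at once.\<close>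
  have bound: "(1 + 1 / r) powr p \<le> 2 powr p * (1 + r powr (- p))" if r: "0 < r" for r
  proof (cases "r \<le> 1")
    case True
    then have "(1 + 1 / r) powr p \<le> (2 / r) powr p"
      using r p by (intro powr_mono2) (auto simp: field_simps)
    also have "\<dots> = 2 powr p * r powr (- p)"
      using r by (simp add: powr_divide powr_minus field_simps)
    finally show ?thesis by (smt (verit) powr_ge_zero mult_left_mono)
  next
    case False
    then have "(1 + 1 / r) powr p \<le> 2 powr p"
      using r p by (intro powr_mono2) (auto simp: field_simps)
    also have "\<dots> \<le> 2 powr p * (1 + r powr (- p))" by simp
    finally show ?thesis .
  qed
  let ?g = "\<lambda>s r. r powr (s - 1) * exp (- r / \<beta>)"
  \<comment> \<open>The majorant is a sum of two Gamma integrands, of shapes \<open>\<alpha>\<close>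
    and \<open>\<alpha> - p\<close>; the second shape is positive since
    \<open>p < \<alpha>\<close>.\<close>
  have le: "gamma_density \<alpha> \<beta> r * exp_q q (1 / (1 - q) / r) \<le>
    K * 2 powr p * (?g \<alpha> r + ?g (\<alpha> - p) r)" if r: "0 < r" for r
  proof -
    have "gamma_density \<alpha> \<beta> r * exp_q q (1 / (1 - q) / r) = K * ?g \<alpha> r * (1 + 1 / r) powr p"
      using r q by (simp add: gamma_density_def exp_q_def K_def p_def)
    also have "\<dots> \<le> K * ?g \<alpha> r * (2 powr p * (1 + r powr (- p)))"
      using K bound[OF r] by (intro mult_left_mono) auto
    also have "\<dots> = K * 2 powr p * (?g \<alpha> r + (r powr (\<alpha> - 1) * r powr (- p)) * exp (- r / \<beta>))"
      by (simp add: algebra_simps)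
    also have "r powr (\<alpha> - 1) * r powr (- p) = r powr (\<alpha> - p - 1)"
      by (simp add: algebra_simps flip: powr_add)
    finally show ?thesis .
  qed
  have "(\<integral>\<^sup>+ r\<in>{0<..}. ennreal (exp_q q (1 / (1 - q) / r)) \<partial>gamma_measure \<alpha> \<beta>) =
    (\<integral>\<^sup>+ r\<in>{0<..}. ennreal (gamma_density \<alpha> \<beta> r) * ennreal (exp_q q (1 / (1 - q) / r)) \<partial>lborel)"
    by (subst nn_integral_gamma_measure) auto
  also have "\<dots> \<le> (\<integral>\<^sup>+ r. ennreal (K * 2 powr p) * (ennreal (?g \<alpha> r) * indicator {0<..} r +
      ennreal (?g (\<alpha> - p) r) * indicator {0<..} r) \<partial>lborel)"
  proof (intro nn_integral_mono)
    fix r :: real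
    show "ennreal (gamma_density \<alpha> \<beta> r) * ennreal (exp_q q (1 / (1 - q) / r)) * indicator {0<..} r
      \<le> ennreal (K * 2 powr p) * (ennreal (?g \<alpha> r) * indicator {0<..} r +
      ennreal (?g (\<alpha> - p) r) * indicator {0<..} r)"
    proof (cases "0 < r")
      case True
      then have "0 \<le> gamma_density \<alpha> \<beta> r"
        using K by (simp add: gamma_density_def K_def)
      then show ?thesis
        using True le[of r] K
        by (simp add: ennreal_leI flip: ennreal_mult' ennreal_mult'' ennreal_plus)
    qed (auto simp: indicator_def)
  qed
  also have "\<dots> = ennreal (K * 2 powr p) * ((\<integral>\<^sup>+ r\<in>{0<..}. ennreal (?g \<alpha> r) \<partial>lborel) +
      (\<integral>\<^sup>+ r\<in>{0<..}. ennreal (?g (\<alpha> - p) r) \<partial>lborel))"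
    by (simp add: nn_integral_cmult nn_integral_add)
  also have "\<dots> < \<infinity>"
    using nn_integral_powr_exp_finite[of \<alpha> \<beta>] nn_integral_powr_exp_finite[of "\<alpha> - p" \<beta>] assms p
    by (auto simp: ennreal_mult_less_top)
  finally have "(\<integral>\<^sup>+ r\<in>{0<..}. ennreal (exp_q q (1 / (1 - q) / r)) \<partial>gamma_measure \<alpha> \<beta>) < \<infinity>" .
  then show ?thesis
    unfolding exp_q_integrable_def exp_q_defined_def q1 by (auto intro: add_pos_pos)
qed

lemma exp_q_integrable_imp_le_1:
  assumes "l > 0" "exp_q_integrable M q l"
  shows "q \<le> 1"
proof (rule ccontr)
  assume q: "\<not> q \<le> 1"
  \<comment> \<open>The domain condition is tested at \<open>r = (q - 1) * l\<close>, where the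
    left-hand side is exactly 0.\<close>
  then have "1 + (1 - q) * (l / ((q - 1) * l)) > 0"
    using assms unfolding exp_q_integrable_def exp_q_defined_def
    by (metis diff_gt_0_iff_gt mult_pos_pos not_le)
  moreover have "(1 - q) * (l / ((q - 1) * l)) = - 1"
    using q assms(1) by (simp add: field_simps)
  ultimately show False by simp
qed

text \<open>Supplies the hypothesis of the divergence criterion: for \<open>q = 1\<close> the
  exponential beats any power, and for \<open>q < 1\<close> the growth exponent
  \<open>1 / (1 - q)\<close> is at least \<open>\<alpha>\<close>.\<close>

lemma exp_q_lower_bound:
  assumes "\<alpha> > 1" "l > 0" "q \<le> 1" "1 - 1 / \<alpha> \<le> q"
  shows "\<exists>C>0. \<forall>r. 0 < r \<longrightarrow> r \<le> 1 \<longrightarrow> C * r powr (- \<alpha>) \<le> exp_q q (l / r)"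
proof (cases "q = 1")
  case True
  \<comment> \<open>Raising \<open>y \<le> exp y\<close> at \<open>y = l / r / \<alpha>\<close> to
    the power \<open>\<alpha>\<close> produces the required negative power of
    \<open>r\<close>.\<close>
  have "(l / \<alpha>) powr \<alpha> * r powr (- \<alpha>) \<le> exp_q q (l / r)" if r: "0 < r" for r
  proof -
    have "(l / \<alpha>) powr \<alpha> * r powr (- \<alpha>) = (l / r / \<alpha>) powr \<alpha>"
      using r assms by (simp add: powr_divide powr_minus powr_mult field_simps)
    also have "\<dots> \<le> exp (l / r / \<alpha>) powr \<alpha>"
    proof (rule powr_mono2)
      show "l / r / \<alpha> \<le> exp (l / r / \<alpha>)"
        using exp_ge_add_one_self[of "l / r / \<alpha>"] by linarith
    qed (use r assms in auto)
    also have "\<dots> = exp_q q (l / r)"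
      using True assms by (simp add: exp_q_def powr_def)
    finally show ?thesis .
  qed
  then show ?thesis using assms by (intro exI[of _ "(l / \<alpha>) powr \<alpha>"]) auto
next
  case False
  define p where "p = 1 / (1 - q)"
  have q: "q < 1" using False assms by simp
  have p: "p \<ge> \<alpha>" using assms q by (auto simp: p_def field_simps)
  have "((1 - q) * l) powr p * r powr (- \<alpha>) \<le> exp_q q (l / r)" if r: "0 < r" "r \<le> 1" for r
  proof -
    \<comment> \<open>Since \<open>r \<le> 1\<close>, enlarging the exponent from
      \<open>\<alpha>\<close> to \<open>p\<close> only increases the negative power; afterwards the
      summand 1 in the base is restored.\<close>
    have "((1 - q) * l) powr p * r powr (- \<alpha>) \<le> ((1 - q) * l) powr p * r powr (- p)"
      using r p by (intro mult_left_mono powr_mono') auto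
    also have "\<dots> = ((1 - q) * (l / r)) powr p"
      using r q assms by (simp add: powr_divide powr_minus powr_mult field_simps)
    also have "\<dots> \<le> (1 + (1 - q) * (l / r)) powr p"
      using r q p assms by (intro powr_mono2) auto
    finally show ?thesis using q by (simp add: exp_q_def p_def)
  qed
  then show ?thesis using q assms by (intro exI[of _ "((1 - q) * l) powr p"]) auto
qed

theorem proposition1:
  fixes \<alpha> \<beta> q :: real
  assumes "\<alpha> > 1" and "\<beta> > 0" and "q > 0"
  shows "(\<exists>l\<^sub>0>0. exp_q_integrable (gamma_measure \<alpha> \<beta>) q l\<^sub>0) \<longleftrightarrow> 0 < q \<and> q < 1 - 1 / \<alpha>"
proof
  assume "\<exists>l\<^sub>0>0. exp_q_integrable (gamma_measure \<alpha> \<beta>) q l\<^sub>0"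
  then obtain l where l: "l > 0" and int: "exp_q_integrable (gamma_measure \<alpha> \<beta>) q l"
    by blast
  have "q < 1 - 1 / \<alpha>"
  proof (rule ccontr)
    assume "\<not> q < 1 - 1 / \<alpha>"
    then obtain C where "C > 0" "\<And>r. 0 < r \<Longrightarrow> r \<le> 1 \<Longrightarrow> C * r powr (- \<alpha>) \<le> exp_q q (l / r)"
      using exp_q_lower_bound[of \<alpha> l q] exp_q_integrable_imp_le_1[OF l int] assms l
      by (auto simp: not_less)
    then have "(\<integral>\<^sup>+ r\<in>{0<..}. ennreal (exp_q q (l / r)) \<partial>gamma_measure \<alpha> \<beta>) = \<infinity>"
      using assms by (intro nn_integral_gamma_measure_eq_infinity[where C = C]) auto
    then show False using int by (simp add: exp_q_integrable_def)
  qed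
  then show "0 < q \<and> q < 1 - 1 / \<alpha>" using \<open>q > 0\<close> by simp
next
  assume q: "0 < q \<and> q < 1 - 1 / \<alpha>"
  moreover have "0 < 1 / \<alpha>" using assms by simp
  ultimately have "q < 1" by linarith
  \<comment> \<open>This number is the witness for \<open>l\<^sub>0\<close>.\<close>
  then have "0 < 1 / (1 - q)" by simp
  then show "\<exists>l\<^sub>0>0. exp_q_integrable (gamma_measure \<alpha> \<beta>) q l\<^sub>0"
    using exp_q_integrable_gamma_measure assms q by blast
qed

end
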